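(* Let $d\ge 2$. For $\mathbf{p}\in(0,\infty)^d$ define $$\Phi(\mathbf{p})=\inf\Big\{\frac{\operatorname{meas}_d K}{(\operatorname{diam} K)^d}\;:\;\boldsymbol\pi\in\Pi_2\times\dots\times\Pi_d,\ K\in\mathcal{T}_d(\mathbf{p},\boldsymbol\pi)\Big\}.$$ Let $\mathbf{p}^\star=(p^\star_1,\dots,p^\star_d)$ with $p_1^\star=1$, $p_2^\star=\frac{1}{\sqrt3}$, $p_j^\star=\frac{1}{j-1}\sqrt{\frac23}$ for $j\in\{3,\dots,d\}$. Then the set of parameters $\mathbf{p}\in(0,\infty)^d$ at which $\Phi$ attains $\sup_{\mathbf{q}\in(0,\infty)^d}\Phi(\mathbf{q})$ is exactly the half-line $P^\star=\{\kappa\mathbf{p}^\star:\kappa>0\}$; this is the unique one-dimensional vector half-space of optimal parameters.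
   Context: $\Pi_i$ denotes the set of permutations of $\{0,\dots,i-1\}$. Construction of $\mathcal{T}_d(\mathbf{p},\boldsymbol\pi)$ for $\boldsymbol\pi=(\pi_2,\dots,\pi_d)$: inductively for $m=1,\dots,d$ define a collection $\mathcal{T}_m$ of $m$-simplices in $\mathbb{R}^m$ with a vertex coloring $c_m$ with colors in $\{0,\dots,m\}$. For $m=1$: vertices $A_z=zp_1$ ($z\in\mathbb{Z}$), simplices the segments between $zp_1$ and $(z+1)p_1$, $c_1(A_z)=z\bmod2$. For $2\le m\le d$: put $c'=\pi_m\circ c_{m-1}$; for each $K\in\mathcal{T}_{m-1}$ label its vertices $A_0,\dots,A_{m-1}$ so that $c'(A_i)=i$, set $B^K_j=(A_{j\bmod m},jp_m)\in\mathbb{R}^m$ for $j\in\mathbb{Z}$, and $L^{K,z}=\operatorname{conv}\{B^K_z,\dots,B^K_{z+m}\}$ for $z\in\mathbb{Z}$; $\mathcal{T}_m=\{L^{K,z}\}$, with vertices $(A,jp_m)$ ($A$ a vertex of $\mathcal{T}_{m-1}$, $j\equiv c'(A)\pmod m$) colored $c_m((A,jp_m))=j\bmod(m+1)$. Then $\mathcal{T}_d(\mathbf{p},\boldsymbol\pi)=\mathcal{T}_d$. $\operatorname{meas}_d$ is $d$-dimensional Lebesgue measure and $\operatorname{diam} K$ is the maximal distance between two points of $K$. *)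

theory Defs
  imports "HOL-Analysis.Analysis" "HOL-Combinatorics.Permutations"
begin

text \<open>Points of R^m are represented as real lists of length m.
  A coloured simplex of T_m is represented as the list of its m+1 vertices,
  ordered by colour: the vertex at position i has colour c_m = i.
  Parameters p = (p_1,...,p_d) are given by p :: nat => real (indices 1..d);
  the permutations pi = (pi_2,...,pi_d) by pi :: nat => nat => nat where
  pi m is a permutation of {0..<m}.\<close>

definition lift_vertex :: "(nat \<Rightarrow> real) \<Rightarrow> (nat \<Rightarrow> nat \<Rightarrow> nat) \<Rightarrow> nat \<Rightarrow> real list list \<Rightarrow> int \<Rightarrow> real list" where
  "lift_vertex p \<pi> m Ks j =
     Ks ! (inv_into {..<m} (\<pi> m) (nat (j mod int m))) @ [of_int j * p m]"

text \<open>The simplex L^{K,z} = conv{B_z,...,B_{z+m}}, vertices listed by colour j mod (m+1).\<close>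
definition lift_simplex :: "(nat \<Rightarrow> real) \<Rightarrow> (nat \<Rightarrow> nat \<Rightarrow> nat) \<Rightarrow> nat \<Rightarrow> real list list \<Rightarrow> int \<Rightarrow> real list list" where
  "lift_simplex p \<pi> m Ks z =
     map (\<lambda>i. lift_vertex p \<pi> m Ks (z + ((int i - z) mod int (m + 1)))) [0..<m + 1]"

text \<open>The segment between z p_1 and (z+1) p_1, vertices listed by colour (j mod 2).\<close>
definition base_simplex :: "(nat \<Rightarrow> real) \<Rightarrow> int \<Rightarrow> real list list" where
  "base_simplex p z = map (\<lambda>i. [of_int (z + ((int i - z) mod 2)) * p 1]) [0..<2]"

fun tri :: "(nat \<Rightarrow> real) \<Rightarrow> (nat \<Rightarrow> nat \<Rightarrow> nat) \<Rightarrow> nat \<Rightarrow> real list list set" where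
  "tri p \<pi> 0 = {}"
| "tri p \<pi> (Suc 0) = {base_simplex p z | z. True}"
| "tri p \<pi> (Suc (Suc k)) =
     {lift_simplex p \<pi> (Suc (Suc k)) Ks z | Ks z. Ks \<in> tri p \<pi> (Suc k)}"

text \<open>Identification of coordinates {0..<CARD('n)} with the index type 'n
  (any fixed bijection; measure and diameter are invariant under it).\<close>
definition coord_index :: "'n::finite \<Rightarrow> nat" where
  "coord_index = (SOME f. bij_betw f (UNIV :: 'n set) {..<CARD('n)})"

definition to_vec :: "real list \<Rightarrow> real ^ 'n::finite" where
  "to_vec xs = (\<chi> i. xs ! coord_index i)"

definition geom :: "real list list \<Rightarrow> (real ^ 'n::finite) set" where
  "geom Ks = convex hull (to_vec ` set Ks)"

definition Phi :: "'n::finite itself \<Rightarrow> (nat \<Rightarrow> real) \<Rightarrow> real" where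
  "Phi (_ :: 'n itself) p =
     Inf {measure lebesgue (geom Ks :: (real ^ 'n) set) / (diameter (geom Ks :: (real ^ 'n) set)) ^ CARD('n)
          | \<pi> Ks. (\<forall>m\<in>{2..CARD('n)}. \<pi> m permutes {..<m}) \<and> Ks \<in> tri p \<pi> CARD('n)}"

definition pstar :: "nat \<Rightarrow> real" where
  "pstar j = (if j = 1 then 1 else if j = 2 then 1 / sqrt 3
              else (1 / real (j - 1)) * sqrt (2 / 3))"

end

theory Submission
  imports Defs
begin

text \<open>
  Above each vertex of the base simplex, \<open>L\<close> has one vertex, except for one vertex of the base
  which has two, at height difference \<open>m p\<^sub>m\<close>. Hence lifting multiplies the volume by \<open>p\<^sub>m\<close>, and all
  simplices have volume \<open>p\<^sub>1 \<cdots> p\<^sub>d\<close>. An edge of \<open>L\<close> is either vertical of length \<open>m p\<^sub>m\<close>, or lies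
  over an edge of the base with height difference at most \<open>(m - 1) p\<^sub>m\<close>, and a suitable permutation
  attains this bound over any prescribed edge. In particular the squared maximal diameter is at least
  \<open>D\<^sub>1 = p\<^sub>1\<^sup>2 + (\<Sum>j\<ge>2. (j - 1)\<^sup>2 p\<^sub>j\<^sup>2)\<close> and \<open>D\<^sub>2 = 4 p\<^sub>2\<^sup>2 + (\<Sum>j\<ge>3. (j - 1)\<^sup>2 p\<^sub>j\<^sup>2)\<close>, hence at least
  \<open>2/3 D\<^sub>1 + 1/3 D\<^sub>2\<close>, to which the inequality of arithmetic and geometric means applies. Its
  equality case is the half-line of \<open>p\<^sup>\<star>\<close>, where the squared diameters are indeed at most
  \<open>D\<^sub>1 = D\<^sub>2\<close>.
\<close>

section \<open>Volumes of simplices\<close>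

text \<open>The preimage of a box under a relabelling of coordinates is a box with the same side
  lengths in another order, and Lebesgue measure is determined by its values on boxes.\<close>

lemma lborel_distr_reindex:
  fixes g :: "'m::finite \<Rightarrow> 'n::finite"
  assumes "bij g"
  shows "distr lborel borel (\<lambda>x :: real^'n. (\<chi> i. x $ g i) :: real^'m) = lborel"
proof (rule lborel_eqI[symmetric])
  have [measurable]: "(\<lambda>x :: real^'n. (\<chi> i. x $ g i) :: real^'m) \<in> borel_measurable borel"
    by (intro borel_measurable_continuous_onI continuous_intros)
  fix l u :: "real^'m"
  assume lu: "\<And>b. b \<in> Basis \<Longrightarrow> l \<bullet> b \<le> u \<bullet> b"
  let ?l = "(\<chi> i. l $ inv g i) :: real^'n" and ?u = "(\<chi> i. u $ inv g i) :: real^'n"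
  have lu': "l $ i \<le> u $ i" for i
    using lu[of "axis i 1"] by (simp add: inner_axis axis_in_Basis_iff)
  have "(\<lambda>x :: real^'n. (\<chi> i. x $ g i) :: real^'m) -` box l u = box ?l ?u"
    using assms
    by (auto simp: mem_box_cart bij_def) (metis inv_f_f surj_f_inv_f)+
  then have "emeasure (distr lborel borel (\<lambda>x :: real^'n. (\<chi> i. x $ g i) :: real^'m)) (box l u)
      = emeasure lborel (box ?l ?u)"
    by (simp add: emeasure_distr)
  also have "\<dots> = ennreal (\<Prod>b\<in>Basis. (?u - ?l) \<bullet> b)"
    using lu' by (intro emeasure_lborel_box) (auto simp: Basis_vec_def inner_axis)
  also have "(\<Prod>b\<in>Basis. (?u - ?l) \<bullet> b) = (\<Prod>i\<in>UNIV. u $ inv g i - l $ inv g i)"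
    unfolding Basis_vec_def
    by (simp add: UNION_singleton_eq_range prod.reindex inj_on_def axis_eq_axis inner_axis)
  also have "\<dots> = (\<Prod>i\<in>UNIV. u $ i - l $ i)"
    by (rule prod.reindex_bij_betw) (simp add: assms bij_imp_bij_inv)
  also have "\<dots> = (\<Prod>b\<in>Basis. (u - l) \<bullet> b)"
    unfolding Basis_vec_def
    by (simp add: UNION_singleton_eq_range prod.reindex inj_on_def axis_eq_axis inner_axis)
  finally show "emeasure (distr lborel borel (\<lambda>x :: real^'n. (\<chi> i. x $ g i) :: real^'m)) (box l u)
      = ennreal (\<Prod>b\<in>Basis. (u - l) \<bullet> b)" .
qed simp

lemma measure_convex_hull_reindex:
  fixes g :: "'m::finite \<Rightarrow> 'n::finite" and X :: "(real^'n) set"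
  assumes "bij g" "finite X"
  shows "measure lebesgue (convex hull ((\<lambda>x. (\<chi> i. x $ g i) :: real^'m) ` X)) = measure lborel (convex hull X)"
proof -
  let ?R = "\<lambda>x :: real^'n. (\<chi> i. x $ g i) :: real^'m"
  have lin: "linear ?R"
    by (intro linearI) (auto simp: vec_eq_iff)
  have inj: "inj ?R"
    using assms(1) by (auto simp: inj_def vec_eq_iff) (metis bij_def surj_f_inv_f)
  have [measurable]: "?R \<in> borel_measurable borel"
    by (intro borel_measurable_continuous_onI continuous_intros)
  have [measurable]: "convex hull (?R ` X) \<in> sets borel"
    using assms(2) by (intro borel_compact finite_imp_compact_convex_hull) auto
  have "measure lebesgue (convex hull (?R ` X)) = measure lborel (convex hull (?R ` X))"
    by (simp add: measure_completion)
  also have "\<dots> = measure (distr lborel borel ?R) (convex hull (?R ` X))"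
    by (simp add: lborel_distr_reindex[OF assms(1)])
  also have "\<dots> = measure lborel (?R -` (convex hull (?R ` X)))"
    by (subst measure_distr) auto
  also have "?R -` (convex hull (?R ` X)) = convex hull X"
    by (subst convex_hull_linear_image[OF lin, symmetric]) (rule inj_vimage_image_eq[OF inj])
  finally show ?thesis .
qed

text \<open>The vertex \<open>x (Suc (r i))\<close> hangs on the earlier vertex
  \<open>x (par i)\<close>, which gives a tree rooted at \<open>x 0\<close>. Edges from the root are
  unitriangular combinations of tree edges, and by \<open>zero\<close> the tree edges form a
  triangular matrix, so only the diagonal entries \<open>a i\<close> enter the determinant.\<close>

lemma content_tree_simplex:
  fixes r :: "'i::{finite,wellorder} \<Rightarrow> nat" and x :: "nat \<Rightarrow> (real, 'i) vec"
  assumes bij: "bij_betw r UNIV {..<CARD('i)}" and mono: "strict_mono r"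
    and inj: "inj_on x {..CARD('i)}"
    and par: "\<And>i. par i \<le> r i"
    and zero: "\<And>i k. k < i \<Longrightarrow> x (Suc (r i)) $ k = x (par i) $ k"
    and diag: "\<And>i. \<bar>x (Suc (r i)) $ i - x (par i) $ i\<bar> = a i"
  shows "measure lborel (convex hull (x ` {..CARD('i)})) = (\<Prod>i\<in>UNIV. a i) / fact CARD('i)"
proof -
  define t where "t i = x (Suc (r i)) - x (par i)" for i
  \<comment> \<open>The tree path from the root to \<open>x n\<close> uses only edges of rank below
    \<open>n\<close> and runs once through the edge into \<open>x n\<close>.\<close>
  have ex: "\<exists>c :: 'i \<Rightarrow> real. (\<forall>k. n \<le> r k \<longrightarrow> c k = 0) \<and> x n - x 0 = (\<Sum>k\<in>UNIV. c k *\<^sub>R t k)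
          \<and> (\<forall>k. n = Suc (r k) \<longrightarrow> c k = 1)" if "n \<le> CARD('i)" for n
    using that
  proof (induction n rule: less_induct)
    case (less n)
    show ?case
    proof (cases n)
      case 0
      then show ?thesis by (intro exI[of _ "\<lambda>_. 0"]) auto
    next
      case (Suc m)
      with less.prems have "m \<in> {..<CARD('i)}" by auto
      then obtain i where i: "r i = m"
        by (metis bij bij_betw_imp_surj_on imageE)
      have inj_r: "r k = m \<longleftrightarrow> k = i" for k
        using i bij by (auto simp: bij_betw_def inj_def)
      have "par i < n" "par i \<le> CARD('i)"
        using par[of i] i Suc less.prems by auto
      from less.IH[OF this] obtain c where
        c: "\<forall>k. par i \<le> r k \<longrightarrow> c k = 0" "x (par i) - x 0 = (\<Sum>k\<in>UNIV. c k *\<^sub>R t k)"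
        by blast
      have "x n - x 0 = (x (par i) - x 0) + t i"
        by (simp add: t_def i Suc)
      also have "\<dots> = (\<Sum>k\<in>UNIV. (c k + (if k = i then 1 else 0)) *\<^sub>R t k)"
        by (simp add: c(2) scaleR_add_left sum.distrib if_distrib[of "\<lambda>a. a *\<^sub>R _"] cong: if_cong)
      finally have eq: "x n - x 0 = (\<Sum>k\<in>UNIV. (c k + (if k = i then 1 else 0)) *\<^sub>R t k)" .
      have "c i = 0"
        using c(1) par[of i] by auto
      moreover have "c k = 0" if "n \<le> r k" for k
        using c(1) that \<open>par i < n\<close> by auto
      moreover have "r i < n"
        using i Suc by simp
      ultimately show ?thesis
        using eq inj_r Suc
        by (intro exI[of _ "\<lambda>k. c k + (if k = i then 1 else 0)"]) auto
    qed
  qed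
  have r_less: "r i < CARD('i)" for i
    using bij by (auto simp: bij_betw_def)
  have "\<exists>c :: 'i \<Rightarrow> real. (\<forall>k. i < k \<longrightarrow> c k = 0) \<and> c i = 1
      \<and> x (Suc (r i)) - x 0 = (\<Sum>k\<in>UNIV. c k *\<^sub>R t k)" for i
    using ex[OF Suc_leI[OF r_less[of i]]] strict_monoD[OF mono, of i] by (metis Suc_leI)
  then obtain c :: "'i \<Rightarrow> 'i \<Rightarrow> real" where c: "\<And>i k. i < k \<Longrightarrow> c i k = 0" "\<And>i. c i i = 1"
     "\<And>i. x (Suc (r i)) - x 0 = (\<Sum>k\<in>UNIV. c i k *\<^sub>R t k)"
    by metis
  define U :: "((real, 'i) vec, 'i) vec" where "U = (\<chi> i k. c i k)"
  define T :: "((real, 'i) vec, 'i) vec" where "T = (\<chi> i. t i)"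
  define M :: "((real, 'i) vec, 'i) vec" where "M = (\<chi> i j. x (Suc (r j)) $ i - x 0 $ i)"
  \<comment> \<open>\<open>U\<close> is lower unitriangular and \<open>T\<close> is upper triangular\<close>
  have "transpose M = U ** T"
    using c(3) by (auto simp: vec_eq_iff transpose_def M_def U_def T_def matrix_matrix_mult_def)
  then have "det M = det U * det T"
    by (metis det_mul det_transpose)
  also have "det U = 1"
    by (subst det_lowerdiagonal) (auto simp: U_def c)
  also have "det T = (\<Prod>i\<in>UNIV. t i $ i)"
    by (subst det_upperdiagonal) (auto simp: T_def t_def zero)
  finally have "\<bar>det M\<bar> = (\<Prod>i\<in>UNIV. a i)"
    by (simp add: abs_prod t_def diag)
  \<comment> \<open>\<open>content_simplex\<close> expects the vertices other than
    \<open>x 0\<close> to be enumerated by the index type.\<close>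
  moreover have "bij_betw (\<lambda>i. x (Suc (r i))) UNIV (x ` {..CARD('i)} - {x 0})"
  proof -
    have "bij_betw Suc {..<CARD('i)} {1..CARD('i)}"
      by (simp add: bij_betw_def lessThan_atLeast0 image_Suc_atLeastLessThan atLeastLessThanSuc_atLeastAtMost)
    moreover have "bij_betw x {1..CARD('i)} (x ` {..CARD('i)} - {x 0})"
    proof -
      have "x ` {..CARD('i)} - {x 0} = x ` ({..CARD('i)} - {0})"
        using inj by (subst inj_on_image_set_diff[OF inj]) auto
      moreover have "{..CARD('i)} - {0} = {1..CARD('i)}" by auto
      ultimately show ?thesis
        using inj by (auto simp: bij_betw_def intro: inj_on_subset)
    qed
    ultimately show ?thesis
      by (rule bij_betw_trans[OF bij_betw_trans[OF bij], unfolded o_def])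
  qed
  ultimately show ?thesis
    using content_simplex[of "x ` {..CARD('i)}" "x 0" "\<lambda>i. x (Suc (r i))"] inj
    by (simp add: card_image M_def)
qed

text \<open>The change of variables formula of the library needs a well-ordered index type, so volumes
  are computed over a well-ordered copy of the index type.\<close>

typedef 'n index = "{..<CARD('n::finite)}"
  morphisms index_rank Index
  using zero_less_card_finite by blast

instantiation index :: (finite) wellorder
begin

definition less_eq_index :: "'a index \<Rightarrow> 'a index \<Rightarrow> bool" where
  "i \<le> j \<longleftrightarrow> index_rank i \<le> index_rank j"

definition less_index :: "'a index \<Rightarrow> 'a index \<Rightarrow> bool" where
  "i < j \<longleftrightarrow> index_rank i < index_rank j"

instance
proof
  fix P :: "'a index \<Rightarrow> bool" and i
  assume *: "\<And>x. (\<And>y. y < x \<Longrightarrow> P y) \<Longrightarrow> P x"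
  show "P i"
    using * by (induction "index_rank i" arbitrary: i rule: less_induct) (metis less_index_def)
qed (auto simp: less_eq_index_def less_index_def index_rank_inject)

end

lemma bij_betw_index_rank: "bij_betw index_rank (UNIV :: 'n::finite index set) {..<CARD('n)}"
  by (rule bij_betwI[where g = Index]) (use index_rank in \<open>auto simp: Index_inverse index_rank_inverse\<close>)

instance index :: (finite) finite
  by standard (metis bij_betw_finite bij_betw_index_rank finite_lessThan)

lemma card_index: "CARD('n::finite index) = CARD('n)"
  using bij_betw_same_card[OF bij_betw_index_rank] by simp

lemma strict_mono_index_rank: "strict_mono (index_rank :: 'n::finite index \<Rightarrow> nat)"
  by (auto simp: strict_mono_def less_index_def)

lemma bij_betw_coord_index: "bij_betw coord_index (UNIV :: 'n::finite set) {..<CARD('n)}"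
proof -
  have "\<exists>f. bij_betw f (UNIV :: 'n set) {..<CARD('n)}"
    by (metis finite_lessThan card_lessThan finite finite_same_card_bij)
  then show ?thesis
    unfolding coord_index_def by (rule someI_ex)
qed

text \<open>The relabelling \<open>g\<close> turns the arbitrary enumeration
  \<open>coord_index\<close> into the strictly increasing \<open>index_rank\<close>, for which the
  tree edges become triangular.\<close>

lemma measure_geom_tree:
  fixes v :: "nat \<Rightarrow> real list"
  assumes v: "v ` {..CARD('n)} = set Ks" and inj: "inj_on v {..CARD('n::finite)}"
    and len: "\<And>x. x \<in> set Ks \<Longrightarrow> length x = CARD('n)"
    and par: "\<And>j. j < CARD('n) \<Longrightarrow> par j \<le> j"
    and zero: "\<And>i j. i < j \<Longrightarrow> j < CARD('n) \<Longrightarrow> v (Suc j) ! i = v (par j) ! i"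
    and diag: "\<And>j. j < CARD('n) \<Longrightarrow> \<bar>v (Suc j) ! j - v (par j) ! j\<bar> = a j"
  shows "measure lebesgue (geom Ks :: (real^'n) set) = (\<Prod>j<CARD('n). a j) / fact CARD('n)"
proof -
  define g :: "'n \<Rightarrow> 'n index" where "g i = Index (coord_index i)" for i
  have c: "coord_index i < CARD('n)" for i :: 'n
    using bij_betw_coord_index by (auto simp: bij_betw_def)
  have rank_g: "index_rank (g i) = coord_index i" for i
    using c by (simp add: g_def Index_inverse)
  have "bij g"
    unfolding g_def using bij_betw_coord_index
    by (rule bij_betw_trans[unfolded o_def])
      (rule bij_betwI[where g = index_rank];
       use index_rank in \<open>auto simp: Index_inverse index_rank_inverse\<close>)
  define w :: "real list \<Rightarrow> real^('n index)" where "w xs = (\<chi> i. xs ! index_rank i)" for xs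
  have less: "index_rank i < CARD('n)" for i :: "'n index"
    using index_rank by auto
  \<comment> \<open>All vertices have as many entries as there are coordinates, so no entry is
    lost.\<close>
  have inj_w: "inj_on w (set Ks)"
  proof (rule inj_onI)
    fix x y assume xy: "x \<in> set Ks" "y \<in> set Ks" "w x = w y"
    then have "x ! index_rank i = y ! index_rank i" for i :: "'n index"
      by (simp add: w_def vec_eq_iff)
    then have "x ! k = y ! k" if "k < CARD('n)" for k
      using that by (metis Index_inverse lessThan_iff)
    with xy show "x = y"
      using len by (auto intro: nth_equalityI)
  qed
  have "to_vec xs = ((\<chi> i. w xs $ g i) :: real^'n)" for xs
    by (auto simp: to_vec_def w_def rank_g)
  then have "(geom Ks :: (real^'n) set) = convex hull ((\<lambda>x. (\<chi> i. x $ g i)) ` w ` set Ks)"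
    by (simp add: geom_def image_image)
  then have "measure lebesgue (geom Ks :: (real^'n) set) = measure lborel (convex hull (w ` set Ks))"
    using measure_convex_hull_reindex[OF \<open>bij g\<close>] by simp
  also have "w ` set Ks = (\<lambda>k. w (v k)) ` {..CARD('n index)}"
    by (simp add: v[symmetric] image_image card_index)
  also have "measure lborel (convex hull \<dots>)
      = (\<Prod>i\<in>UNIV. a (index_rank (i :: 'n index))) / fact CARD('n index)"
  proof (rule content_tree_simplex[where par = "\<lambda>i. par (index_rank i)"])
    show "bij_betw (index_rank :: 'n index \<Rightarrow> nat) UNIV {..<CARD('n index)}"
      using bij_betw_index_rank[where 'n = 'n] by (simp add: card_index)
    show "inj_on (\<lambda>k. w (v k)) {..CARD('n index)}"
      using comp_inj_on[OF inj, of w] inj_w v by (simp add: card_index o_def)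
  qed (use less par zero diag strict_mono_index_rank in
       \<open>auto simp: w_def less_index_def\<close>)
  also have "(\<Prod>i\<in>UNIV. a (index_rank (i :: 'n index))) = (\<Prod>j<CARD('n). a j)"
    by (rule prod.reindex_bij_betw[OF bij_betw_index_rank])
  finally show ?thesis by (simp add: card_index)
qed

section \<open>Vertices of lifted simplices\<close>

lemma bij_betw_nat_mod_window:
  assumes "0 < m"
  shows "bij_betw (\<lambda>j. nat (j mod int m)) {z..<z + int m} {..<m}"
proof (rule bij_betw_imageI)
  show inj: "inj_on (\<lambda>j. nat (j mod int m)) {z..<z + int m}"
  proof (rule inj_onI)
    fix i j assume ij: "i \<in> {z..<z + int m}" "j \<in> {z..<z + int m}"
      and "nat (i mod int m) = nat (j mod int m)"
    then have "i mod int m = j mod int m"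
      using assms by (metis eq_nat_nat_iff of_nat_0_less_iff pos_mod_sign)
    then have "int m dvd i - j"
      by (simp add: mod_eq_dvd_iff)
    moreover have "\<bar>i - j\<bar> < int m"
      using ij by auto
    ultimately show "i = j"
      using zdvd_imp_le[of "int m" "\<bar>i - j\<bar>"] by fastforce
  qed
  show "(\<lambda>j. nat (j mod int m)) ` {z..<z + int m} = {..<m}"
    by (rule card_subset_eq) (use assms in \<open>auto simp: card_image[OF inj] nat_less_iff\<close>)
qed

text \<open>List position in the base simplex is the colour before relabelling by
  \<open>\<pi> m\<close>. Hence the vertex below \<open>B\<^sub>j\<close> sits at the position that
  \<open>\<pi> m\<close> sends to the residue of \<open>j\<close>.\<close>

definition vertex_pos :: "(nat \<Rightarrow> nat \<Rightarrow> nat) \<Rightarrow> nat \<Rightarrow> int \<Rightarrow> nat" where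
  "vertex_pos \<pi> m j = inv_into {..<m} (\<pi> m) (nat (j mod int m))"

lemma lift_vertex_eq: "lift_vertex p \<pi> m Ks j = Ks ! vertex_pos \<pi> m j @ [of_int j * p m]"
  by (simp add: lift_vertex_def vertex_pos_def)

lemma vertex_pos_period: "vertex_pos \<pi> m (j + int m) = vertex_pos \<pi> m j"
  by (simp add: vertex_pos_def)

lemma bij_betw_vertex_pos:
  assumes "0 < m" "\<pi> m permutes {..<m}"
  shows "bij_betw (vertex_pos \<pi> m) {z..<z + int m} {..<m}"
proof -
  have "bij_betw (inv_into {..<m} (\<pi> m)) {..<m} {..<m}"
    using assms(2) by (simp add: bij_betw_inv_into permutes_imp_bij)
  from bij_betw_trans[OF bij_betw_nat_mod_window[OF assms(1)] this] show ?thesis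
    by (simp add: vertex_pos_def[abs_def] o_def)
qed

lemma vertex_pos_less:
  assumes "0 < m" "\<pi> m permutes {..<m}"
  shows "vertex_pos \<pi> m j < m"
  using bij_betwE[OF bij_betw_vertex_pos[where z = j and \<pi> = \<pi>, OF assms]] assms(1) by auto

text \<open>The entry of colour \<open>i\<close> is the only \<open>j\<close> in the window with
  \<open>j\<close> congruent to \<open>i\<close> modulo \<open>m + 1\<close>. Listing by colour thus
  merely reorders the window.\<close>

lemma set_lift_simplex: "set (lift_simplex p \<pi> m Ks z) = lift_vertex p \<pi> m Ks ` {z..z + int m}"
proof -
  let ?f = "\<lambda>i. z + (int i - z) mod int (m + 1)"
  have "?f ` {0..<m + 1} = {z..z + int m}"
  proof
    show "?f ` {0..<m + 1} \<subseteq> {z..z + int m}"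
    proof (rule image_subsetI)
      fix i
      have "0 \<le> (int i - z) mod int (m + 1)" "(int i - z) mod int (m + 1) < int (m + 1)"
        by (rule pos_mod_sign pos_mod_bound; simp)+
      then show "?f i \<in> {z..z + int m}" by (simp only: of_nat_add of_nat_1 atLeastAtMost_iff) linarith
    qed
    show "{z..z + int m} \<subseteq> ?f ` {0..<m + 1}"
    proof
      fix j assume j: "j \<in> {z..z + int m}"
      define i where "i = nat (j mod int (m + 1))"
      have "int i = j mod int (m + 1)" "i < m + 1"
        by (simp_all add: i_def nat_less_iff)
      then have "?f i = z + (j - z) mod int (m + 1)"
        by (simp add: mod_diff_left_eq)
      also have "\<dots> = j"
        using j by (simp add: mod_pos_pos_trivial)
      finally show "j \<in> ?f ` {0..<m + 1}"
        using \<open>i < m + 1\<close> by (intro image_eqI[of _ _ i]) auto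
    qed
  qed
  then show ?thesis
    by (simp only: lift_simplex_def set_map set_upt image_image flip: image_image[of "lift_vertex p \<pi> m Ks" ?f])
qed

lemma lift_simplex_0_nth:
  assumes "i \<le> m"
  shows "lift_simplex p \<pi> m Ks 0 ! i = lift_vertex p \<pi> m Ks (int i)"
  using assms by (simp add: lift_simplex_def nth_map_upt del: upt_Suc)

lemma length_lift_simplex [simp]: "length (lift_simplex p \<pi> m Ks z) = Suc m"
  by (simp add: lift_simplex_def)

lemma tri_Suc:
  assumes "1 \<le> m"
  shows "tri p \<pi> (Suc m) = {lift_simplex p \<pi> (Suc m) Ks z | Ks z. Ks \<in> tri p \<pi> m}"
  using assms by (cases m) auto

lemma length_tri:
  assumes "1 \<le> m" "Ks \<in> tri p \<pi> m"
  shows "length Ks = Suc m"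
  using assms by (induction m rule: nat_induct_at_least) (auto simp: base_simplex_def tri_Suc)

lemma length_vertex_tri:
  assumes "1 \<le> m" "Ks \<in> tri p \<pi> m" "\<forall>k\<in>{2..m}. \<pi> k permutes {..<k}" "x \<in> set Ks"
  shows "length x = m"
  using assms
proof (induction m arbitrary: Ks x rule: nat_induct_at_least)
  case base
  then show ?case by (auto simp: base_simplex_def)
next
  case (Suc m)
  then obtain Ks' z where Ks: "Ks = lift_simplex p \<pi> (Suc m) Ks' z" "Ks' \<in> tri p \<pi> m"
    by (auto simp: tri_Suc)
  have "Ks' ! vertex_pos \<pi> (Suc m) j \<in> set Ks'" for j
    using Suc.prems Suc.hyps length_tri[OF Suc.hyps Ks(2)] vertex_pos_less[of "Suc m" \<pi> j] by auto
  then show ?case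
    using Suc.prems Suc.IH[OF Ks(2)] by (auto simp: Ks(1) set_lift_simplex lift_vertex_eq)
qed

text \<open>The vertices numbered \<open>Suc m\<close> and \<open>par m\<close> in the lift of an \<open>m\<close>-simplex are the first and the
  last one, which lie above the same vertex.\<close>

lemma tri_vertex_tree:
  assumes "1 \<le> m" "Ks \<in> tri p \<pi> m" "\<forall>k\<in>{2..m}. \<pi> k permutes {..<k}" "\<forall>k\<in>{1..m}. 0 < p k"
  shows "\<exists>v par. v ` {..m} = set Ks \<and> inj_on v {..m} \<and>
    (\<forall>j<m. par j \<le> j \<and> (\<forall>i<j. v (Suc j) ! i = v (par j) ! i) \<and>
       \<bar>v (Suc j) ! j - v (par j) ! j\<bar> = real (Suc j) * p (Suc j))"
  using assms
proof (induction m arbitrary: Ks rule: nat_induct_at_least)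
  case base
  then obtain z where z: "Ks = base_simplex p z" by auto
  have p1: "0 < p 1" using base by simp
  define v where "v k = [of_int (z + int k) * p 1]" for k
  \<comment> \<open>The parity of \<open>z\<close> decides which end point of the segment has colour
    0.\<close>
  have "(- z) mod 2 = 0 \<and> (1 - z) mod 2 = 1 \<or> (- z) mod 2 = 1 \<and> (1 - z) mod 2 = 0"
    by presburger
  then have "set Ks = {v 0, v 1}"
    by (auto simp: z base_simplex_def v_def numeral_2_eq_2)
  moreover have "{..1::nat} = {0, 1}" by auto
  moreover have "\<bar>v 1 ! 0 - v 0 ! 0\<bar> = p 1"
    using p1 by (simp add: v_def algebra_simps)
  moreover have "inj_on v {..1}"
    using p1 by (auto simp: v_def inj_on_def)
  ultimately show ?case
    by (intro exI[of _ v] exI[of _ "\<lambda>_. 0"]) auto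
next
  case (Suc m)
  define n where "n = Suc m"
  obtain Ks' z where Ks: "Ks = lift_simplex p \<pi> n Ks' z" "Ks' \<in> tri p \<pi> m"
    using Suc.prems Suc.hyps by (auto simp: tri_Suc n_def)
  have perm: "\<pi> n permutes {..<n}" "0 < n"
    using Suc.prems Suc.hyps by (auto simp: n_def)
  have pn: "0 < p n" using Suc.prems by (auto simp: n_def)
  have "\<forall>k\<in>{2..m}. \<pi> k permutes {..<k}" "\<forall>k\<in>{1..m}. 0 < p k"
    using Suc.prems by auto
  from Suc.IH[OF Ks(2) this] obtain u par where u: "u ` {..m} = set Ks'" "inj_on u {..m}"
    and par: "\<And>j. j < m \<Longrightarrow> par j \<le> j" "\<And>i j. j < m \<Longrightarrow> i < j \<Longrightarrow> u (Suc j) ! i = u (par j) ! i"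
       "\<And>j. j < m \<Longrightarrow> \<bar>u (Suc j) ! j - u (par j) ! j\<bar> = real (Suc j) * p (Suc j)"
    by blast
  have len: "length Ks' = n"
    using length_tri[OF Suc.hyps Ks(2)] by (simp add: n_def)
  have lenu: "length (u k) = m" if "k \<le> m" for k
    using length_vertex_tri[OF Suc.hyps Ks(2)] Suc.prems(2) that by (simp flip: u(1))
  have "card (set Ks') = n"
    using u by (metis card_image card_atMost n_def)
  then have "distinct Ks'"
    using len by (simp add: card_distinct)
  define g where "g j = Ks' ! vertex_pos \<pi> n j" for j
  have "bij_betw ((!) Ks') {..<n} (set Ks')"
    using \<open>distinct Ks'\<close> len bij_betw_nth by blast
  from bij_betw_trans[OF bij_betw_vertex_pos[where z = z and \<pi> = \<pi>, OF perm(2,1)] this]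
  have g: "bij_betw g {z..<z + int n} (set Ks')"
    by (simp add: g_def[abs_def] o_def)
  \<comment> \<open>\<open>h k\<close> is the level at which \<open>u k\<close> is lifted. The
    window is half-open because its excluded end \<open>z + int n\<close> lies above the same vertex
    as \<open>z\<close>.\<close>
  define h where "h k = inv_into {z..<z + int n} g (u k)" for k
  have "u k \<in> g ` {z..<z + int n}" if "k \<le> m" for k
    using that u(1) bij_betw_imp_surj_on[OF g] by blast
  then have h: "h k \<in> {z..<z + int n}" "g (h k) = u k" if "k \<le> m" for k
    using that unfolding h_def by (metis inv_into_into, metis f_inv_into_f)
  have gz: "g (z + int n) = g z"
    by (simp add: g_def vertex_pos_period)
  have "g z \<in> set Ks'"
    using bij_betwE[OF g] perm(2) by auto
  \<comment> \<open>\<open>k0\<close> is the number of the base vertex that is lifted twice.\<close>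
  then obtain k0 where k0: "k0 \<le> m" "u k0 = g z"
    by (metis imageE atMost_iff u(1))
  have hk0: "h k0 = z"
    using g perm(2) by (simp add: h_def k0 bij_betw_def inv_into_f_f)
  \<comment> \<open>The lower lifts keep the numbers of the base vertices; the top vertex gets the
    new number and hangs on the vertex directly below it.\<close>
  define v where "v k = (if k \<le> m then u k @ [of_int (h k) * p n] else g z @ [of_int (z + int n) * p n])" for k
  define par' where "par' j = (if j < m then par j else k0)" for j
  have vn: "v n = g (z + int n) @ [of_int (z + int n) * p n]"
    unfolding gz by (simp add: v_def n_def)
  have "v ` {..n} = v ` {..m} \<union> {v n}"
    by (auto simp: n_def atMost_Suc)
  also have "v ` {..m} = (\<lambda>j. g j @ [of_int j * p n]) ` {z..<z + int n}"
  proof -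
    have "h ` {..m} = inv_into {z..<z + int n} g ` u ` {..m}"
      by (simp only: h_def[abs_def] image_image)
    also have "u ` {..m} = set Ks'" by (fact u(1))
    also have "inv_into {z..<z + int n} g ` set Ks' = {z..<z + int n}"
      using bij_betw_inv_into[OF g] by (rule bij_betw_imp_surj_on)
    finally have hm: "h ` {..m} = {z..<z + int n}" .
    have "(\<lambda>j. g j @ [of_int j * p n]) ` {z..<z + int n}
       = (\<lambda>k. g (h k) @ [of_int (h k) * p n]) ` {..m}"
      by (simp only: image_image flip: hm)
    also have "\<dots> = v ` {..m}"
      by (rule image_cong) (auto simp: v_def h)
    finally show ?thesis ..
  qed
  also have "\<dots> \<union> {v n} = (\<lambda>j. g j @ [of_int j * p n]) ` ({z..<z + int n} \<union> {z + int n})"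
    by (simp only: vn image_Un image_insert image_empty)
  also have "{z..<z + int n} \<union> {z + int n} = {z..z + int n}"
    by auto
  also have "(\<lambda>j. g j @ [of_int j * p n]) ` {z..z + int n} = set Ks"
    by (simp add: Ks(1) set_lift_simplex lift_vertex_eq[abs_def] g_def)
  finally have v_im: "v ` {..n} = set Ks" .
  have "inj_on v {..n}"
  proof -
    have "inj_on v {..m}"
      using u(2) by (auto simp: inj_on_def v_def)
    moreover have "v n \<noteq> v k" if "k \<le> m" for k
    proof
      assume "v n = v k"
      then have "u k = u k0" "of_int (h k) * p n = of_int (z + int n) * p n"
        using that by (auto simp: v_def n_def k0)
      moreover from this(1) have "k = k0"
        using u(2) that k0 by (auto simp: inj_on_def)
      ultimately show False
        using pn hk0 perm(2) by simp
    qed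
    ultimately show ?thesis
      by (auto simp: n_def atMost_Suc)
  qed
  moreover have "par' j \<le> j" if "j < n" for j
    using that par(1) k0 by (auto simp: par'_def n_def)
  \<comment> \<open>Old tree edges keep their first \<open>m\<close> coordinates under lifting; the
    new one is vertical.\<close>
  moreover have "v (Suc j) ! i = v (par' j) ! i" if "j < n" "i < j" for i j
  proof (cases "j < m")
    case True
    then show ?thesis
      using that par(1)[OF True] par(2)[OF True] lenu by (auto simp: v_def par'_def nth_append)
  next
    case False
    then have "j = m" using that by (simp add: n_def)
    then show ?thesis
      using that k0 lenu[of k0] by (auto simp: v_def par'_def nth_append)
  qed
  moreover have "\<bar>v (Suc j) ! j - v (par' j) ! j\<bar> = real (Suc j) * p (Suc j)" if "j < n" for j
  proof (cases "j < m")
    case True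
    then show ?thesis
      using par(1)[OF True] par(3)[OF True] lenu by (auto simp: v_def par'_def nth_append)
  next
    case False
    then have j: "j = m" using that by (simp add: n_def)
    have "v (Suc j) ! j - v (par' j) ! j = of_int (z + int n) * p n - of_int z * p n"
      using k0 lenu[of k0] hk0 by (auto simp: j v_def par'_def nth_append)
    also have "\<dots> = real n * p n"
      by (simp add: algebra_simps)
    finally show ?thesis
      using pn by (simp add: j n_def abs_mult)
  qed
  ultimately show ?case
    using v_im unfolding n_def[symmetric] by (intro exI[of _ v] exI[of _ par']) auto
qed

section \<open>Edge lengths and diameters\<close>

definition sqdist :: "real list \<Rightarrow> real list \<Rightarrow> real" where
  "sqdist xs ys = (\<Sum>k<length xs. (xs ! k - ys ! k)\<^sup>2)"

lemma sqdist_snoc: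
  assumes "length xs = length ys"
  shows "sqdist (xs @ [a]) (ys @ [b]) = sqdist xs ys + (a - b)\<^sup>2"
  using assms by (simp add: sqdist_def nth_append)

lemma dist_to_vec:
  assumes "length xs = CARD('n::finite)"
  shows "dist (to_vec xs :: real^'n) (to_vec ys) = sqrt (sqdist xs ys)"
proof -
  have "(\<Sum>i\<in>UNIV. (xs ! coord_index (i::'n) - ys ! coord_index i)\<^sup>2) = sqdist xs ys"
    unfolding sqdist_def assms
    by (rule sum.reindex_bij_betw[OF bij_betw_coord_index])
  then show ?thesis
    by (simp add: dist_vec_def L2_set_def to_vec_def dist_real_def)
qed

lemma le_diameter_geom:
  assumes "x \<in> set Ks" "y \<in> set Ks" "length x = CARD('n::finite)"
  shows "sqrt (sqdist x y) \<le> diameter (geom Ks :: (real^'n) set)"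
proof -
  have "to_vec x \<in> (geom Ks :: (real^'n) set)" "to_vec y \<in> (geom Ks :: (real^'n) set)"
    using assms by (auto simp: geom_def intro: hull_inc)
  moreover have "bounded (geom Ks :: (real^'n) set)"
    by (simp add: geom_def finite_imp_bounded_convex_hull)
  ultimately show ?thesis
    using diameter_bounded_bound[of "geom Ks" "to_vec x :: real^'n" "to_vec y"] dist_to_vec[OF assms(3)]
    by simp
qed

text \<open>The greatest distance in the convex hull of a finite set is attained between two of the
  given points.\<close>

lemma diameter_geom_le:
  assumes "Ks \<noteq> []" "\<And>x. x \<in> set Ks \<Longrightarrow> length x = CARD('n::finite)"
    and "\<And>x y. x \<in> set Ks \<Longrightarrow> y \<in> set Ks \<Longrightarrow> sqdist x y \<le> D"
  shows "diameter (geom Ks :: (real^'n) set) \<le> sqrt D"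
proof (rule diameter_le)
  show "(geom Ks :: (real^'n) set) \<noteq> {} \<or> 0 \<le> sqrt D"
    using assms(1) by (simp add: geom_def)
next
  fix a b :: "real^'n" assume ab: "a \<in> geom Ks" "b \<in> geom Ks"
  obtain x y where xy: "x \<in> set Ks" "y \<in> set Ks"
     "norm (a - b) \<le> norm (to_vec x - to_vec y :: real^'n)"
    using simplex_extremal_le[of "to_vec ` set Ks :: (real^'n) set"] assms(1) ab
    unfolding geom_def by auto
  then show "norm (a - b) \<le> sqrt D"
    using dist_to_vec[OF assms(2)[OF xy(1)], of y] assms(3)[OF xy(1,2)]
    by (smt (verit) dist_norm real_sqrt_le_iff)
qed

text \<open>The coefficient of \<open>(p j)\<^sup>2\<close> in 2/3 \<open>D\<^sub>1\<close> + 1/3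
  \<open>D\<^sub>2\<close>. For \<open>j = 2\<close> it is 2/3 * 1 + 1/3 * 4 = 2.\<close>

definition weight :: "nat \<Rightarrow> real" where
  "weight j = (if j = 1 then 2 / 3 else if j = 2 then 2 else (real (j - 1))\<^sup>2)"

lemma weight_pos: "1 \<le> j \<Longrightarrow> 0 < weight j"
  by (auto simp: weight_def)

lemma pstar_pos: "1 \<le> j \<Longrightarrow> 0 < pstar j"
  by (auto simp: pstar_def)

text \<open>The value does not depend on \<open>j\<close>, which is the equality case of the
  inequality of arithmetic and geometric means.\<close>

lemma weight_pstar:
  assumes "1 \<le> j"
  shows "weight j * (pstar j)\<^sup>2 = 2 / 3"
  using assms by (auto simp: weight_def pstar_def power_mult_distrib power_divide)

lemma sqdist_lift_simplex_le:
  assumes "0 < m" "\<pi> m permutes {..<m}" "length Ks = m"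
    and "\<And>x. x \<in> set Ks \<Longrightarrow> length x = l"
    and "\<And>x y. x \<in> set Ks \<Longrightarrow> y \<in> set Ks \<Longrightarrow> sqdist x y \<le> D"
    and "x \<in> set (lift_simplex p \<pi> m Ks z)" "y \<in> set (lift_simplex p \<pi> m Ks z)"
  shows "sqdist x y \<le> max ((real m * p m)\<^sup>2) (D + (real (m - 1) * p m)\<^sup>2)"
proof -
  define g where "g j = Ks ! vertex_pos \<pi> m j" for j
  have g: "g j \<in> set Ks" for j
    using vertex_pos_less[where \<pi> = \<pi>, OF assms(1,2)] assms(3) by (simp add: g_def)
  obtain i j where ij: "i \<in> {z..z + int m}" "j \<in> {z..z + int m}"
    and xy: "x = g i @ [of_int i * p m]" "y = g j @ [of_int j * p m]"
    using assms(6,7) by (auto simp: set_lift_simplex lift_vertex_eq g_def)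
  have "length (g i) = length (g j)" using assms(4)[OF g] by simp
  then have eq: "sqdist x y = sqdist (g i) (g j) + (of_int i * p m - of_int j * p m)\<^sup>2"
    by (simp add: xy sqdist_snoc)
  have sq: "(of_int i * p m - of_int j * p m)\<^sup>2 = (of_int \<bar>i - j\<bar>)\<^sup>2 * (p m)\<^sup>2"
    by (simp add: power_mult_distrib flip: left_diff_distrib)
  have "\<bar>i - j\<bar> \<le> int m" using ij by auto
  then consider "\<bar>i - j\<bar> = int m" | "\<bar>i - j\<bar> \<le> int m - 1" by linarith
  then show ?thesis
  proof cases
    case 1
    \<comment> \<open>Levels that differ by \<open>m\<close> lie above the same base vertex, so the
      edge is vertical; otherwise the base edge contributes at most \<open>D\<close>.\<close>
    then have "i = j + int m \<or> j = i + int m" by linarith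
    then have "g i = g j" by (auto simp: g_def vertex_pos_period)
    then have "sqdist x y = (real m * p m)\<^sup>2"
      unfolding eq sq 1 by (simp add: sqdist_def power_mult_distrib)
    then show ?thesis by simp
  next
    case 2
    have "real_of_int \<bar>i - j\<bar> \<le> real (m - 1)"
      using 2 assms(1) by (simp add: of_nat_diff)
    then have "(of_int \<bar>i - j\<bar>)\<^sup>2 * (p m)\<^sup>2 \<le> (real (m - 1))\<^sup>2 * (p m)\<^sup>2"
      by (intro mult_right_mono power_mono) auto
    then show ?thesis
      unfolding eq sq using assms(5)[OF g g, of i j] by (simp add: power_mult_distrib)
  qed
qed

text \<open>The bound is 1 at level 1 and 4/3 at level 2, and each further level adds 2/3, up to the
  factor \<open>\<kappa>\<^sup>2\<close>. Vertical edges never exceed it.\<close>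

lemma sqdist_tri_pstar_le:
  assumes "1 \<le> m" "Ks \<in> tri p \<pi> m" "\<forall>k\<in>{2..m}. \<pi> k permutes {..<k}"
    and "\<forall>k\<in>{1..m}. p k = \<kappa> * pstar k" "x \<in> set Ks" "y \<in> set Ks"
  shows "sqdist x y \<le> \<kappa>\<^sup>2 * (if m = 1 then 1 else 2 * real m / 3)"
  using assms
proof (induction m arbitrary: Ks x y rule: nat_induct_at_least)
  case base
  then obtain z where "Ks = base_simplex p z" and p1: "p 1 = \<kappa>"
    by (auto simp: pstar_def)
  moreover have "(- z) mod 2 = 0 \<and> (1 - z) mod 2 = 1 \<or> (- z) mod 2 = 1 \<and> (1 - z) mod 2 = 0"
    by presburger
  ultimately have "set Ks = {[of_int z * \<kappa>], [of_int (z + 1) * \<kappa>]}"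
    by (auto simp: base_simplex_def numeral_2_eq_2)
  then have "x \<in> {[of_int z * \<kappa>], [of_int (z + 1) * \<kappa>]}" "y \<in> {[of_int z * \<kappa>], [of_int (z + 1) * \<kappa>]}"
    using base.prems(4,5) by blast+
  moreover have "sqdist x y \<le> (a - b)\<^sup>2" if "x \<in> {[a], [b]}" "y \<in> {[a], [b]}" for a b
    using that by (auto simp: sqdist_def power2_commute)
  ultimately have "sqdist x y \<le> (of_int z * \<kappa> - of_int (z + 1) * \<kappa>)\<^sup>2" by blast
  also have "\<dots> = \<kappa>\<^sup>2" by (simp add: algebra_simps)
  finally show ?case by simp
next
  case (Suc m)
  define n where "n = Suc m"
  obtain Ks' z where Ks: "Ks = lift_simplex p \<pi> n Ks' z" "Ks' \<in> tri p \<pi> m"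
    using Suc.prems Suc.hyps by (auto simp: tri_Suc n_def)
  have perm: "\<pi> n permutes {..<n}" "0 < n"
    using Suc.prems Suc.hyps by (auto simp: n_def)
  have pn: "p n = \<kappa> * pstar n" using Suc.prems by (auto simp: n_def)
  let ?D = "\<kappa>\<^sup>2 * (if m = 1 then 1 else 2 * real m / 3)"
  have "sqdist x y \<le> max ((real n * p n)\<^sup>2) (?D + (real (n - 1) * p n)\<^sup>2)"
  proof (rule sqdist_lift_simplex_le[where \<pi> = \<pi>, OF perm(2,1)])
    show "length Ks' = n" using length_tri[OF Suc.hyps Ks(2)] by (simp add: n_def)
    show "length x = m" if "x \<in> set Ks'" for x
      using length_vertex_tri[OF Suc.hyps Ks(2) _ that] Suc.prems by auto
    show "sqdist x y \<le> ?D" if "x \<in> set Ks'" "y \<in> set Ks'" for x y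
      using Suc.IH[OF Ks(2) _ _ that] Suc.prems by auto
  qed (use Suc.prems in \<open>auto simp: Ks(1)\<close>)
  also have "\<dots> \<le> \<kappa>\<^sup>2 * (2 * real n / 3)"
  proof (cases "m = 1")
    case True
    then have "n = 2" by (simp add: n_def)
    \<comment> \<open>At level 2 the vertical edge gives 4/3 and the slanted one 1 + 1/3, so both
      are extremal.\<close>
    then show ?thesis using True pn by (simp add: pstar_def power_mult_distrib power_divide)
  next
    case False
    then have n: "3 \<le> n" using Suc.hyps by (simp add: n_def)
    then have sq: "(real (n - 1))\<^sup>2 * (pstar n)\<^sup>2 = 2 / 3"
      using weight_pstar[of n] by (simp add: weight_def)
    \<comment> \<open>For \<open>n\<close> at least 3 the ratio of \<open>n\<close> to
      \<open>n - 1\<close> is at most 3/2, so a vertical edge has squared length at most 3/2,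
      whereas the bound is at least 2.\<close>
    have "(real n)\<^sup>2 \<le> (9/4) * (real (n - 1))\<^sup>2"
    proof -
      have "real n \<le> 3/2 * real (n - 1)" using n by (simp add: of_nat_diff)
      from power_mono[OF this, of 2] show ?thesis
        by (simp only: power_mult_distrib power_divide) simp
    qed
    then have "(real n)\<^sup>2 * (pstar n)\<^sup>2 \<le> (9/4) * (real (n - 1))\<^sup>2 * (pstar n)\<^sup>2"
      by (intro mult_right_mono) auto
    also have "\<dots> = 3 / 2" by (simp only: mult.assoc sq)
    also have "\<dots> \<le> 2 * real n / 3" using n by simp
    finally have "(real n * p n)\<^sup>2 \<le> \<kappa>\<^sup>2 * (2 * real n / 3)"
      using mult_left_mono[of "(real n)\<^sup>2 * (pstar n)\<^sup>2" "2 * real n / 3" "\<kappa>\<^sup>2"]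
      by (simp add: pn power_mult_distrib mult_ac)
    moreover have "?D + (real (n - 1) * p n)\<^sup>2 = \<kappa>\<^sup>2 * (2 * real m / 3 + (real (n - 1))\<^sup>2 * (pstar n)\<^sup>2)"
      using False by (simp add: pn power_mult_distrib algebra_simps)
    moreover have "2 * real m / 3 + 2 / 3 = 2 * real n / 3" by (simp add: n_def)
    ultimately show ?thesis by (simp only: sq max.bounded_iff order.refl simp_thms)
  qed
  finally show ?case using Suc.hyps by (simp add: n_def)
qed

section \<open>Simplices with prescribed long edges\<close>

lemma tri_cong:
  assumes "\<And>k. 2 \<le> k \<Longrightarrow> k \<le> m \<Longrightarrow> \<pi> k = \<pi>' k"
  shows "tri p \<pi> m = tri p \<pi>' m"
  using assms
  by (induction p \<pi> m rule: tri.induct) (auto simp: lift_simplex_def lift_vertex_def)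

lemma permutation_with_two_values:
  assumes "a \<in> S" "b \<in> S" "c \<in> S" "d \<in> S" "a \<noteq> b" "c \<noteq> d"
  obtains \<tau> where "\<tau> permutes S" "\<tau> a = c" "\<tau> b = d"
proof
  let ?s = "Transposition.transpose a c"
  \<comment> \<open>The first transposition moves \<open>a\<close> to \<open>c\<close>; the second
    moves the image of \<open>b\<close> to \<open>d\<close> and fixes \<open>c\<close>, which
    differs from both.\<close>
  show "Transposition.transpose (?s b) d \<circ> ?s permutes S"
    by (intro permutes_compose permutes_swap_id) (use assms in \<open>auto simp: Transposition.transpose_def\<close>)
  show "(Transposition.transpose (?s b) d \<circ> ?s) a = c" "(Transposition.transpose (?s b) d \<circ> ?s) b = d"
    using assms by (auto simp: Transposition.transpose_def)
qed

text \<open>Recolouring the end points to 0 and \<open>m\<close> puts their lifts in the simplex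
  with \<open>z = 0\<close> at heights 0 and \<open>m * p (Suc m)\<close>, the largest gap over a
  nondegenerate base edge.\<close>

lemma tri_long_edge_Suc:
  assumes "1 \<le> m" "Ks \<in> tri p \<pi> m" "\<forall>k\<in>{2..m}. \<pi> k permutes {..<k}"
    and "a \<le> m" "b \<le> m" "a \<noteq> b"
  shows "\<exists>\<pi>' Ks' a' b'. (\<forall>k\<in>{2..Suc m}. \<pi>' k permutes {..<k}) \<and> Ks' \<in> tri p \<pi>' (Suc m) \<and>
    a' \<le> Suc m \<and> b' \<le> Suc m \<and> a' \<noteq> b' \<and>
    sqdist (Ks' ! a') (Ks' ! b') = sqdist (Ks ! a) (Ks ! b) + (real m * p (Suc m))\<^sup>2"
proof -
  obtain \<tau> where \<tau>: "\<tau> permutes {..<Suc m}" "\<tau> a = 0" "\<tau> b = m"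
    using permutation_with_two_values[of a "{..<Suc m}" b 0 m] assms by auto
  define \<pi>' where "\<pi>' = \<pi>(Suc m := \<tau>)"
  define Ks' where "Ks' = lift_simplex p \<pi>' (Suc m) Ks 0"
  have perm: "\<forall>k\<in>{2..Suc m}. \<pi>' k permutes {..<k}"
    using assms(3) \<tau>(1) by (auto simp: \<pi>'_def)
  have "tri p \<pi>' m = tri p \<pi> m"
    by (rule tri_cong) (auto simp: \<pi>'_def)
  then have Ks': "Ks' \<in> tri p \<pi>' (Suc m)"
    using assms(1,2) by (auto simp: tri_Suc Ks'_def)
  have "inv_into {..<Suc m} \<tau> 0 = a" "inv_into {..<Suc m} \<tau> m = b"
    using \<tau> assms(4,5) permutes_inj_on[OF \<tau>(1)] by (auto intro: inv_into_f_eq)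
  then have "Ks' ! 0 = Ks ! a @ [0]" "Ks' ! m = Ks ! b @ [real m * p (Suc m)]"
    using lift_simplex_0_nth[of 0 "Suc m" p \<pi>' Ks] lift_simplex_0_nth[of m "Suc m" p \<pi>' Ks]
    by (simp_all add: Ks'_def lift_vertex_def \<pi>'_def)
  moreover have "length (Ks ! a) = length (Ks ! b)"
    using length_vertex_tri[OF assms(1-3)] length_tri[OF assms(1,2)] assms(4,5) by auto
  ultimately have "sqdist (Ks' ! 0) (Ks' ! m) = sqdist (Ks ! a) (Ks ! b) + (real m * p (Suc m))\<^sup>2"
    by (simp add: sqdist_snoc)
  then show ?thesis
    using perm Ks' assms(1) by (intro exI[of _ \<pi>'] exI[of _ Ks'] exI[of _ 0] exI[of _ m]) auto
qed

lemma tri_long_edge: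
  assumes "1 \<le> s" "s \<le> m" "Ks \<in> tri p \<pi> s" "\<forall>k\<in>{2..s}. \<pi> k permutes {..<k}"
    and "a \<le> s" "b \<le> s" "a \<noteq> b" "sqdist (Ks ! a) (Ks ! b) = D"
  shows "\<exists>\<pi>' Ks' a' b'. (\<forall>k\<in>{2..m}. \<pi>' k permutes {..<k}) \<and> Ks' \<in> tri p \<pi>' m \<and>
    a' \<le> m \<and> b' \<le> m \<and> a' \<noteq> b' \<and>
    sqdist (Ks' ! a') (Ks' ! b') = D + (\<Sum>j=Suc s..m. (real (j - 1) * p j)\<^sup>2)"
  using assms(2)
proof (induction m rule: dec_induct)
  case base
  then show ?case using assms by force
next
  case (step m)
  then obtain \<pi>' Ks' a' b' where *: "\<forall>k\<in>{2..m}. \<pi>' k permutes {..<k}" "Ks' \<in> tri p \<pi>' m"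
    "a' \<le> m" "b' \<le> m" "a' \<noteq> b'"
    "sqdist (Ks' ! a') (Ks' ! b') = D + (\<Sum>j=Suc s..m. (real (j - 1) * p j)\<^sup>2)"
    by blast
  have "1 \<le> m" using step assms(1) by simp
  from tri_long_edge_Suc[OF this *(2,1,3-5)] show ?case
    using step by (simp add: *(6) add.assoc)
qed

text \<open>Prolonging the initial segment through all levels yields
  \<open>D\<^sub>1\<close>.\<close>

lemma tri_edge_from_level_1:
  assumes "1 \<le> d"
  shows "\<exists>\<pi> Ks a b. (\<forall>k\<in>{2..d}. \<pi> k permutes {..<k}) \<and> Ks \<in> tri p \<pi> d \<and>
    a \<le> d \<and> b \<le> d \<and> a \<noteq> b \<and>
    sqdist (Ks ! a) (Ks ! b) = (p 1)\<^sup>2 + (\<Sum>j=Suc 1..d. (real (j - 1) * p j)\<^sup>2)"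
proof -
  have K: "base_simplex p 0 \<in> tri p (\<lambda>_. id) 1" by auto
  have sq: "sqdist (base_simplex p 0 ! 0) (base_simplex p 0 ! 1) = (p 1)\<^sup>2"
    by (simp add: base_simplex_def sqdist_def numeral_2_eq_2)
  show ?thesis
    by (rule tri_long_edge[OF _ assms K _ _ _ _ sq]) auto
qed

text \<open>Prolonging a vertical edge of a triangle yields \<open>D\<^sub>2\<close>.\<close>

lemma tri_edge_from_level_2:
  assumes "2 \<le> d"
  shows "\<exists>\<pi> Ks a b. (\<forall>k\<in>{2..d}. \<pi> k permutes {..<k}) \<and> Ks \<in> tri p \<pi> d \<and>
    a \<le> d \<and> b \<le> d \<and> a \<noteq> b \<and>
    sqdist (Ks ! a) (Ks ! b) = (2 * p 2)\<^sup>2 + (\<Sum>j=Suc 2..d. (real (j - 1) * p j)\<^sup>2)"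
proof -
  define Ks where "Ks = lift_simplex p (\<lambda>_. id) 2 (base_simplex p 0) 0"
  have K: "Ks \<in> tri p (\<lambda>_. id) 2"
    unfolding Ks_def by (auto simp: numeral_2_eq_2)
  have "Ks ! 0 = base_simplex p 0 ! vertex_pos (\<lambda>_. id) 2 0 @ [0]"
       "Ks ! 2 = base_simplex p 0 ! vertex_pos (\<lambda>_. id) 2 0 @ [2 * p 2]"
    using vertex_pos_period[of "\<lambda>_. id" 2 0]
    by (simp_all add: Ks_def lift_simplex_0_nth lift_vertex_eq)
  then have sq: "sqdist (Ks ! 0) (Ks ! 2) = (2 * p 2)\<^sup>2"
    by (simp add: sqdist_snoc) (simp add: sqdist_def)
  show ?thesis
    by (rule tri_long_edge[OF _ assms K _ _ _ _ sq]) (auto simp: permutes_id)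
qed

section \<open>Optimal parameters\<close>

text \<open>With \<open>t = y i / \<mu>\<close>, the terms \<open>t - 1 - ln t\<close> are
  nonnegative, and by \<open>ge\<close> their sum is at most 0. So each vanishes, which forces
  \<open>t = 1\<close>.\<close>

lemma am_gm_equality:
  fixes y :: "'a \<Rightarrow> real"
  assumes A: "finite A" "A \<noteq> {}" and pos: "\<And>i. i \<in> A \<Longrightarrow> 0 < y i"
    and ge: "(sum y A / card A) ^ card A \<le> prod y A" and "i \<in> A"
  shows "y i = sum y A / card A"
proof -
  define \<mu> where "\<mu> = sum y A / card A"
  have card: "0 < card A" using A by (simp add: card_gt_0_iff)
  have \<mu>: "0 < \<mu>"
    using A pos card by (simp add: \<mu>_def sum_pos)
  have le: "0 \<le> y i / \<mu> - 1 - ln (y i / \<mu>)" if "i \<in> A" for i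
    using ln_le_minus_one[of "y i / \<mu>"] pos[OF that] \<mu> by simp
  have "y i \<noteq> 0" if "i \<in> A" for i
    using pos[OF that] by simp
  then have "(\<Sum>i\<in>A. y i / \<mu> - 1 - ln (y i / \<mu>)) = sum y A / \<mu> - card A - ln (\<Prod>i\<in>A. y i / \<mu>)"
    using A pos \<mu> by (subst ln_prod) (auto simp: sum_subtractf sum_divide_distrib)
  also have "sum y A / \<mu> = card A"
    using card \<mu> by (simp add: \<mu>_def field_simps)
  also have "(\<Prod>i\<in>A. y i / \<mu>) = prod y A / \<mu> ^ card A"
    by (simp add: prod_dividef)
  also have "real (card A) - real (card A) - ln (prod y A / \<mu> ^ card A) \<le> 0"
    using ge \<mu> by (simp add: \<mu>_def[symmetric] le_divide_eq)
  finally have "(\<Sum>i\<in>A. y i / \<mu> - 1 - ln (y i / \<mu>)) = 0"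
    using sum_nonneg[of A "\<lambda>i. y i / \<mu> - 1 - ln (y i / \<mu>)"] le by fastforce
  then have "y i / \<mu> - 1 - ln (y i / \<mu>) = 0"
    using sum_nonneg_eq_0_iff[of A "\<lambda>i. y i / \<mu> - 1 - ln (y i / \<mu>)"] le A \<open>i \<in> A\<close> by simp
  then have "y i / \<mu> = 1"
    using ln_eq_minus_one[of "y i / \<mu>"] pos[OF \<open>i \<in> A\<close>] \<mu> by simp
  then show ?thesis using \<mu> by (simp add: \<mu>_def[symmetric])
qed

text \<open>A violation would satisfy the hypothesis of the equality case, make all
  \<open>y i\<close> equal, and hence be no violation.\<close>

lemma am_gm:
  fixes y :: "'a \<Rightarrow> real"
  assumes A: "finite A" "A \<noteq> {}" and pos: "\<And>i. i \<in> A \<Longrightarrow> 0 < y i"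
  shows "prod y A \<le> (sum y A / card A) ^ card A"
proof (rule ccontr)
  assume *: "\<not> ?thesis"
  then have "y i = sum y A / card A" if "i \<in> A" for i
    using am_gm_equality[of A y i, OF A pos] that by simp
  then have "prod y A = (sum y A / card A) ^ card A"
    by (metis (no_types, lifting) prod.cong prod_constant)
  with * show False by simp
qed

section \<open>Bounds for \<open>Phi\<close>\<close>

lemma measure_geom_tri:
  assumes Ks: "Ks \<in> tri p \<pi> CARD('n::finite)" and perm: "\<forall>k\<in>{2..CARD('n)}. \<pi> k permutes {..<k}"
    and pos: "\<forall>k\<in>{1..CARD('n)}. 0 < p k"
  shows "measure lebesgue (geom Ks :: (real^'n) set) = (\<Prod>j=1..CARD('n). p j)"
proof -
  have d: "1 \<le> CARD('n)" by (simp add: Suc_le_eq)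
  obtain v par where v: "v ` {..CARD('n)} = set Ks" "inj_on v {..CARD('n)}"
    and par: "\<And>j. j < CARD('n) \<Longrightarrow> par j \<le> j"
      "\<And>i j. i < j \<Longrightarrow> j < CARD('n) \<Longrightarrow> v (Suc j) ! i = v (par j) ! i"
      "\<And>j. j < CARD('n) \<Longrightarrow> \<bar>v (Suc j) ! j - v (par j) ! j\<bar> = real (Suc j) * p (Suc j)"
    using tri_vertex_tree[OF d Ks perm pos] by blast
  have "measure lebesgue (geom Ks :: (real^'n) set) =
      (\<Prod>j<CARD('n). real (Suc j) * p (Suc j)) / fact CARD('n)"
    by (rule measure_geom_tree[OF v length_vertex_tri[OF d Ks perm] par])
  \<comment> \<open>The factors \<open>Suc j\<close> of the tree edges cancel the factorial.\<close>
  also have "(\<Prod>j<CARD('n). real (Suc j) * p (Suc j)) = fact CARD('n) * (\<Prod>j=1..CARD('n). p j)"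
    by (simp add: prod.distrib fact_prod_Suc prod.atLeast1_atMost_eq lessThan_atLeast0)
  finally show ?thesis by simp
qed

text \<open>The first tree edge changes the first coordinate by \<open>p 1\<close>. Positivity is
  what permits comparing quotients by the diameter.\<close>

lemma diameter_geom_tri_pos:
  assumes Ks: "Ks \<in> tri p \<pi> CARD('n::finite)" and perm: "\<forall>k\<in>{2..CARD('n)}. \<pi> k permutes {..<k}"
    and pos: "\<forall>k\<in>{1..CARD('n)}. 0 < p k"
  shows "0 < diameter (geom Ks :: (real^'n) set)"
proof -
  have d: "1 \<le> CARD('n)" by (simp add: Suc_le_eq)
  obtain v par where v: "v ` {..CARD('n)} = set Ks"
    and tree: "\<forall>j<CARD('n). par j \<le> j \<and> (\<forall>i<j. v (Suc j) ! i = v (par j) ! i) \<and>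
       \<bar>v (Suc j) ! j - v (par j) ! j\<bar> = real (Suc j) * p (Suc j)"
    using tri_vertex_tree[OF d Ks perm pos] by (elim exE conjE)
  from tree[rule_format, of 0]
  have "\<bar>v 1 ! 0 - v 0 ! 0\<bar> = p 1"
    by auto
  moreover have in_Ks: "v 0 \<in> set Ks" "v 1 \<in> set Ks"
    using v d by auto
  then have len: "length (v 1) = CARD('n)"
    using length_vertex_tri[OF d Ks perm] by blast
  moreover have "0 < p 1" using pos d by simp
  ultimately have "v 1 ! 0 - v 0 ! 0 \<noteq> 0" by auto
  then have "0 < (v 1 ! 0 - v 0 ! 0)\<^sup>2"
    by (rule zero_less_power2[THEN iffD2])
  also have "\<dots> \<le> sqdist (v 1) (v 0)"
    unfolding sqdist_def
    by (rule member_le_sum[where f = "\<lambda>k. (v 1 ! k - v 0 ! k)\<^sup>2"]) (use len in auto)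
  finally have "0 < sqrt (sqdist (v 1) (v 0))" by simp
  also have "\<dots> \<le> diameter (geom Ks :: (real^'n) set)"
    by (rule le_diameter_geom[OF in_Ks(2,1) len])
  finally show ?thesis .
qed

definition weighted_sum :: "nat \<Rightarrow> (nat \<Rightarrow> real) \<Rightarrow> real" where
  "weighted_sum d q = (\<Sum>j=1..d. weight j * (q j)\<^sup>2)"

lemma weighted_square_pos:
  assumes "1 \<le> j" "0 < q j"
  shows "0 < weight j * (q j :: real)\<^sup>2"
  using assms weight_pos by simp

lemma weighted_sum_pos:
  assumes "1 \<le> d" "\<forall>j\<in>{1..d}. 0 < q j"
  shows "0 < weighted_sum d q"
  unfolding weighted_sum_def using assms weighted_square_pos by (intro sum_pos) auto

text \<open>The weights are chosen such that the weighted sum is the average, with weights 2/3 and 1/3, of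
  the squared lengths of two edges.\<close>

lemma exists_long_edge:
  assumes "2 \<le> d"
  shows "\<exists>\<pi> Ks a b. (\<forall>k\<in>{2..d}. \<pi> k permutes {..<k}) \<and> Ks \<in> tri q \<pi> d \<and>
    a \<le> d \<and> b \<le> d \<and> weighted_sum d q \<le> sqdist (Ks ! a) (Ks ! b)"
proof -
  define R where "R = (\<Sum>j=Suc 2..d. (real (j - 1) * q j)\<^sup>2)"
  have "weighted_sum d q = weight 1 * (q 1)\<^sup>2 + weight 2 * (q 2)\<^sup>2 + (\<Sum>j=Suc 2..d. weight j * (q j)\<^sup>2)"
    unfolding weighted_sum_def using assms
    by (simp add: sum.atLeast_Suc_atMost numeral_2_eq_2)
  also have "(\<Sum>j=Suc 2..d. weight j * (q j)\<^sup>2) = R"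
    unfolding R_def by (rule sum.cong) (auto simp: weight_def power_mult_distrib)
  finally have S: "weighted_sum d q = 2 / 3 * (q 1)\<^sup>2 + 2 * (q 2)\<^sup>2 + R"
    by (simp add: weight_def)
  have "(\<Sum>j=Suc 1..d. (real (j - 1) * q j)\<^sup>2) = (q 2)\<^sup>2 + R"
    unfolding R_def using assms by (simp add: sum.atLeast_Suc_atMost numeral_2_eq_2)
  then have avg: "weighted_sum d q = 2 / 3 * ((q 1)\<^sup>2 + (\<Sum>j=Suc 1..d. (real (j - 1) * q j)\<^sup>2))
      + 1 / 3 * ((2 * q 2)\<^sup>2 + R)"
    by (simp only: S) (simp add: power_mult_distrib field_simps)
  \<comment> \<open>If one of two numbers falls below their weighted average, the other reaches
    it.\<close>
  have above: "w \<le> x" if "w = 2 / 3 * x + 1 / 3 * y" "\<not> w \<le> y" for w x y :: real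
    using that by linarith
  show ?thesis
  proof (cases "weighted_sum d q \<le> (2 * q 2)\<^sup>2 + R")
    case True
    then show ?thesis
      using tri_edge_from_level_2[OF assms, of q] unfolding R_def by metis
  next
    case False
    then have "weighted_sum d q \<le> (q 1)\<^sup>2 + (\<Sum>j=Suc 1..d. (real (j - 1) * q j)\<^sup>2)"
      using above[OF avg] by blast
    moreover have "1 \<le> d" using assms by simp
    ultimately show ?thesis
      using tri_edge_from_level_1[of d q] by metis
  qed
qed

text \<open>The numerator is the same for all simplices, so a simplex with a long edge bounds the
  infimum from above.\<close>

lemma Phi_le:
  assumes d: "2 \<le> CARD('n::finite)" and pos: "\<forall>j\<in>{1..CARD('n)}. 0 < q j"
  shows "Phi TYPE('n) q \<le> (\<Prod>j=1..CARD('n). q j) / sqrt (weighted_sum CARD('n) q) ^ CARD('n)"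
proof -
  obtain \<pi> Ks a b where perm: "\<forall>k\<in>{2..CARD('n)}. \<pi> k permutes {..<k}" and Ks: "Ks \<in> tri q \<pi> CARD('n)"
    and ab: "a \<le> CARD('n)" "b \<le> CARD('n)" "weighted_sum CARD('n) q \<le> sqdist (Ks ! a) (Ks ! b)"
    using exists_long_edge[OF d, of q] by blast
  have d1: "1 \<le> CARD('n)" using d by simp
  have in_Ks: "Ks ! a \<in> set Ks" "Ks ! b \<in> set Ks"
    using ab length_tri[OF d1 Ks] by auto
  have "Phi TYPE('n) q \<le> measure lebesgue (geom Ks :: (real^'n) set) / diameter (geom Ks :: (real^'n) set) ^ CARD('n)"
    unfolding Phi_def
  proof (rule cInf_lower)
    show "bdd_below {measure lebesgue (geom Ks :: (real^'n) set) / diameter (geom Ks :: (real^'n) set) ^ CARD('n) | \<pi> Ks.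
       (\<forall>m\<in>{2..CARD('n)}. \<pi> m permutes {..<m}) \<and> Ks \<in> tri q \<pi> CARD('n)}"
      by (rule bdd_belowI[of _ 0])
        (auto intro!: divide_nonneg_nonneg zero_le_power diameter_ge_0 simp: geom_def finite_imp_bounded_convex_hull)
  qed (use perm Ks in blast)
  also have "\<dots> \<le> (\<Prod>j=1..CARD('n). q j) / sqrt (weighted_sum CARD('n) q) ^ CARD('n)"
    unfolding measure_geom_tri[OF Ks perm pos]
  proof (intro divide_left_mono power_mono)
    have "sqrt (weighted_sum CARD('n) q) \<le> sqrt (sqdist (Ks ! a) (Ks ! b))"
      using ab by simp
    also have "\<dots> \<le> diameter (geom Ks :: (real^'n) set)"
      by (rule le_diameter_geom[OF in_Ks length_vertex_tri[OF d1 Ks perm in_Ks(1)]])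
    finally show "sqrt (weighted_sum CARD('n) q) \<le> diameter (geom Ks :: (real^'n) set)" .
  qed (use pos weighted_sum_pos[OF d1 pos] diameter_geom_tri_pos[OF Ks perm pos] in
      \<open>auto intro!: prod_pos mult_pos_pos less_imp_le\<close>)
  finally show ?thesis .
qed

lemma weighted_sum_pstar:
  assumes "\<forall>j\<in>{1..d}. p j = \<kappa> * pstar j"
  shows "weighted_sum d p = \<kappa>\<^sup>2 * (2 * real d / 3)"
proof -
  have "weight j * (p j)\<^sup>2 = \<kappa>\<^sup>2 * (2 / 3)" if "j \<in> {1..d}" for j
    using weight_pstar[of j] assms that by (simp add: power_mult_distrib mult.left_commute)
  then have "weighted_sum d p = (\<Sum>j=1..d. \<kappa>\<^sup>2 * (2 / 3))"
    unfolding weighted_sum_def by (rule sum.cong[OF refl])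
  then show ?thesis by simp
qed

text \<open>On the half-line the weighted sum bounds every squared edge length, so the bound of
  \<open>Phi_le\<close> is attained.\<close>

lemma Phi_pstar_ge:
  assumes d: "2 \<le> CARD('n::finite)" and "0 < \<kappa>" and p: "\<forall>j\<in>{1..CARD('n)}. p j = \<kappa> * pstar j"
  shows "(\<Prod>j=1..CARD('n). p j) / sqrt (weighted_sum CARD('n) p) ^ CARD('n) \<le> Phi TYPE('n) p"
  unfolding Phi_def
proof (rule cInf_greatest)
  show "{measure lebesgue (geom Ks :: (real^'n) set) / diameter (geom Ks :: (real^'n) set) ^ CARD('n) | \<pi> Ks.
       (\<forall>m\<in>{2..CARD('n)}. \<pi> m permutes {..<m}) \<and> Ks \<in> tri p \<pi> CARD('n)} \<noteq> {}"
    using exists_long_edge[OF d, of p] by blast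
next
  have pos: "\<forall>j\<in>{1..CARD('n)}. 0 < p j"
    using p \<open>0 < \<kappa>\<close> pstar_pos by auto
  have d1: "1 \<le> CARD('n)" using d by simp
  fix r assume "r \<in> {measure lebesgue (geom Ks :: (real^'n) set) / diameter (geom Ks :: (real^'n) set) ^ CARD('n) | \<pi> Ks.
       (\<forall>m\<in>{2..CARD('n)}. \<pi> m permutes {..<m}) \<and> Ks \<in> tri p \<pi> CARD('n)}"
  then obtain \<pi> Ks where r: "r = measure lebesgue (geom Ks :: (real^'n) set) / diameter (geom Ks :: (real^'n) set) ^ CARD('n)"
    and perm: "\<forall>m\<in>{2..CARD('n)}. \<pi> m permutes {..<m}" and Ks: "Ks \<in> tri p \<pi> CARD('n)"
    by blast
  have "sqdist x y \<le> weighted_sum CARD('n) p" if "x \<in> set Ks" "y \<in> set Ks" for x y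
    using sqdist_tri_pstar_le[OF d1 Ks perm p that] d by (simp add: weighted_sum_pstar[OF p])
  then have "diameter (geom Ks :: (real^'n) set) \<le> sqrt (weighted_sum CARD('n) p)"
    using length_tri[OF d1 Ks] length_vertex_tri[OF d1 Ks perm] by (intro diameter_geom_le) auto
  then show "(\<Prod>j=1..CARD('n). p j) / sqrt (weighted_sum CARD('n) p) ^ CARD('n) \<le> r"
    unfolding r measure_geom_tri[OF Ks perm pos]
    using pos diameter_geom_tri_pos[OF Ks perm pos] weighted_sum_pos[OF d1 pos]
    by (intro divide_left_mono power_mono) (auto intro!: prod_pos mult_pos_pos less_imp_le)
qed

text \<open>Up to a constant and a square root, the bound is the product of the weighted squares
  over the matching power of their mean, the quotient controlled by \<open>am_gm\<close>.\<close>

lemma normalized_product_eq: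
  assumes "1 \<le> d" "\<forall>j\<in>{1..d}. 0 < q j"
  shows "(\<Prod>j=1..d. q j) / sqrt (weighted_sum d q) ^ d =
    sqrt ((\<Prod>j=1..d. weight j * (q j)\<^sup>2) / (weighted_sum d q / d) ^ d) / sqrt ((\<Prod>j=1..d. weight j) * real d ^ d)"
proof -
  have S: "0 < weighted_sum d q"
    by (rule weighted_sum_pos[OF assms])
  then have "(sqrt (weighted_sum d q) ^ d)\<^sup>2 = weighted_sum d q ^ d"
    by (metis power_mult mult.commute real_sqrt_pow2 less_imp_le)
  then have eq: "(\<Prod>j=1..d. weight j * (q j)\<^sup>2) / (weighted_sum d q / d) ^ d =
      ((\<Prod>j=1..d. weight j) * real d ^ d) * ((\<Prod>j=1..d. q j) / sqrt (weighted_sum d q) ^ d)\<^sup>2"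
    by (simp add: prod.distrib power_divide prod_power_distrib)
  have "x = sqrt (k * x\<^sup>2) / sqrt k" if "0 < k" "0 \<le> x" for k x :: real
    using that by (simp add: real_sqrt_mult)
  moreover have "0 < (\<Prod>j=1..d. weight j) * real d ^ d"
    using assms(1) by (intro mult_pos_pos prod_pos) (auto intro: weight_pos)
  moreover have "0 \<le> (\<Prod>j=1..d. q j) / sqrt (weighted_sum d q) ^ d"
    using S assms(2) by (intro divide_nonneg_nonneg prod_nonneg) (auto intro: less_imp_le)
  ultimately show ?thesis
    unfolding eq by blast
qed

theorem theorem3:
  assumes "CARD('n::finite) \<ge> 2"
  shows "\<forall>p. (\<forall>j\<in>{1..CARD('n)}. 0 < p j) \<longrightarrow>
           (Phi TYPE('n) p = (SUP q\<in>{q. \<forall>j\<in>{1..CARD('n)}. 0 < q j}. Phi TYPE('n) q)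
            \<longleftrightarrow> (\<exists>\<kappa>>0. \<forall>j\<in>{1..CARD('n)}. p j = \<kappa> * pstar j))"
proof -
  define d where "d = CARD('n)"
  have d: "2 \<le> d" "1 \<le> d" using assms by (auto simp: d_def)
  \<comment> \<open>\<open>1 / C\<close> will be the maximum, and \<open>G\<close> is the quotient
    of means, at most 1 with equality only for equal weighted squares.\<close>
  define C where "C = sqrt ((\<Prod>j=1..d. weight j) * real d ^ d)"
  define G where "G q = (\<Prod>j=1..d. weight j * (q j)\<^sup>2) / (weighted_sum d q / d) ^ d" for q
  let ?P = "{q. \<forall>j\<in>{1..d}. 0 < q j}"
  have C: "0 < C"
    using d by (auto simp: C_def intro!: mult_pos_pos prod_pos weight_pos)
  have sum_pos: "0 < weighted_sum d q / d" if "q \<in> ?P" for q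
    using weighted_sum_pos[OF d(2)] that d by auto
  have le: "Phi TYPE('n) q \<le> sqrt (G q) / C" if "q \<in> ?P" for q
    using Phi_le[of q, where 'n = 'n] normalized_product_eq[OF d(2), of q] that d
    by (simp add: C_def G_def d_def)
  have ge: "sqrt (G q) / C \<le> Phi TYPE('n) q" if "0 < \<kappa>" "\<forall>j\<in>{1..d}. q j = \<kappa> * pstar j" for q \<kappa>
    using Phi_pstar_ge[of \<kappa> q, where 'n = 'n] normalized_product_eq[OF d(2), of q] that d pstar_pos
    by (simp add: C_def G_def d_def)
  have G_le: "G q \<le> 1" if "q \<in> ?P" for q
    using am_gm[of "{1..d}" "\<lambda>j. weight j * (q j)\<^sup>2"] sum_pos[OF that] that d weighted_square_pos
    by (auto simp: G_def weighted_sum_def)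
  have G_eq: "weight j * (q j)\<^sup>2 = weighted_sum d q / d" if "q \<in> ?P" "1 \<le> G q" "j \<in> {1..d}" for q j
    using am_gm_equality[of "{1..d}" "\<lambda>j. weight j * (q j)\<^sup>2" j] sum_pos[OF that(1)] that d weighted_square_pos
    by (auto simp: G_def weighted_sum_def le_divide_eq)
  have G_pstar: "G q = 1" if "0 < \<kappa>" "\<forall>j\<in>{1..d}. q j = \<kappa> * pstar j" for q \<kappa>
  proof -
    have "weight j * (q j)\<^sup>2 = \<kappa>\<^sup>2 * (2 / 3)" if "j \<in> {1..d}" for j
      using weight_pstar[of j] that \<open>\<forall>j\<in>{1..d}. q j = \<kappa> * pstar j\<close>
      by (simp add: power_mult_distrib mult.left_commute)
    then have prod_eq: "(\<Prod>j=1..d. weight j * (q j)\<^sup>2) = (\<Prod>j=1..d. \<kappa>\<^sup>2 * (2 / 3))"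
      by (rule prod.cong[OF refl])
    have mean_eq: "weighted_sum d q / d = \<kappa>\<^sup>2 * (2 / 3)"
      using d by (simp add: weighted_sum_pstar[OF that(2)])
    show ?thesis
      unfolding G_def prod_eq mean_eq using that(1) by simp
  qed
  have upper: "Phi TYPE('n) q \<le> 1 / C" if "q \<in> ?P" for q
    using G_le[OF that] C by (intro order_trans[OF le[OF that]] divide_right_mono) auto
  have attained: "Phi TYPE('n) q = 1 / C" if "0 < \<kappa>" "\<forall>j\<in>{1..d}. q j = \<kappa> * pstar j" for q \<kappa>
  proof -
    have "q \<in> ?P" using that pstar_pos by auto
    then show ?thesis using upper[of q] ge[OF that] G_pstar[OF that] by simp
  qed
  have "pstar \<in> ?P" "Phi TYPE('n) pstar = 1 / C"
    using pstar_pos attained[of 1 pstar] by auto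
  then have Sup: "(SUP q\<in>?P. Phi TYPE('n) q) = 1 / C"
    using upper by (intro cSup_eq_maximum) (metis imageI, blast)
  have "\<exists>\<kappa>>0. \<forall>j\<in>{1..d}. p j = \<kappa> * pstar j" if p: "p \<in> ?P" and eq: "Phi TYPE('n) p = 1 / C" for p
  \<comment> \<open>The factor must be \<open>p 1\<close>, since \<open>pstar 1 = 1\<close>.\<close>
  proof (intro exI[of _ "p 1"] conjI ballI)
    show "0 < p 1" using p d by auto
    have "1 / C \<le> sqrt (G p) / C" using le[OF p] eq by simp
    then have G: "1 \<le> G p" using C by (simp add: divide_le_cancel)
    fix j assume j: "j \<in> {1..d}"
    \<comment> \<open>The weighted squares of \<open>p\<close> agree, as do those of
      \<open>pstar\<close>; dividing the two equalities and taking positive roots gives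
      proportionality.\<close>
    have w1: "weight 1 = weight j * (pstar j)\<^sup>2"
      using weight_pstar[of j] weight_pstar[of 1] j by (simp add: pstar_def[of "Suc 0"])
    have "weight j * (p j)\<^sup>2 = weight 1 * (p 1)\<^sup>2"
      using G_eq[OF p G j] G_eq[OF p G, of 1] d by simp
    also have "\<dots> = weight j * (p 1 * pstar j)\<^sup>2"
      unfolding w1 by (simp only: power_mult_distrib mult_ac)
    finally have "(p j)\<^sup>2 = (p 1 * pstar j)\<^sup>2"
      using weight_pos[of j] j by simp
    then show "p j = p 1 * pstar j"
      using p j d pstar_pos[of j] by (simp add: power2_eq_iff_nonneg less_imp_le)
  qed
  with attained have iff: "Phi TYPE('n) p = 1 / C \<longleftrightarrow> (\<exists>\<kappa>>0. \<forall>j\<in>{1..d}. p j = \<kappa> * pstar j)"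
    if "p \<in> ?P" for p
    using that by (intro iffI) (assumption | blast)+
  show ?thesis
    unfolding d_def[symmetric] Sup
  proof (intro allI impI)
    fix p :: "nat \<Rightarrow> real" assume "\<forall>j\<in>{1..d}. 0 < p j"
    then show "Phi TYPE('n) p = 1 / C \<longleftrightarrow> (\<exists>\<kappa>>0. \<forall>j\<in>{1..d}. p j = \<kappa> * pstar j)"
      by (intro iff) simp
  qed
qed

end
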